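(* Let $\rho\ge 0$, $s>\rho$, $\sigma>0$, and let $f,g:\mathbb{R}^n\to\mathbb{R}$ ($n\ge1$) be such that: $g$ is $\rho$-weakly convex; $f$ is second-order differentiable and $\|\nabla f(x)-\nabla f(y)\|_2\le\sigma\|x-y\|_2$ for all $x,y\in\mathbb{R}^n$; and $x\mapsto f(x)-\frac{s}{2}\|x\|_2^2$ is convex. For $\alpha>0$ let $$T_\alpha=(2J_{\alpha f}-I)(2J_{\alpha g}-I),\qquad V_\alpha=(2K_2-I)(2K_1-I),$$ where $$K_1(x)=J_{\beta_1 g}\Bigl(\frac{\beta_1}{\alpha}x\Bigr),\quad K_2(x)=J_{\beta_2 f}\Bigl(\frac{\beta_2}{\alpha}x\Bigr),\quad \beta_1=\frac{\alpha}{1+\alpha\rho},\quad \beta_2=\frac{\alpha}{1-\alpha\rho}.$$ If $0<\alpha\le 1/\sqrt{\sigma s}$, then for all $x,y\in\mathbb{R}^n$, $$\|T_\alpha(x)-T_\alpha(y)\|_2\le\frac{(1-\alpha^2 s\rho)-\alpha(s-\rho)}{(1-\alpha^2 s\rho)+\alpha(s-\rho)}\,\|x-y\|_2.$$ If $0<\alpha\le 1/s$, then for all $x,y\in\mathbb{R}^n$, $$\|V_\alpha(x)-V_\alpha(y)\|_2\le\gamma\,\|x-y\|_2,\qquad \gamma=\max\left(\frac{|1-\alpha(\sigma-\rho)|}{1+\alpha(\sigma-\rho)},\ \frac{1-\alpha(s-\rho)}{1+\alpha(s-\rho)}\right).$$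
   Context: A function $g:\mathbb{R}^n\to\mathbb{R}$ is $\rho$-weakly convex if $x\mapsto g(x)+\frac{t}{2}\|x\|_2^2$ is convex for all $t\ge\rho$. For $\alpha>0$, the proximity operator of a function $q$ is $J_{\alpha q}(x)=\arg\min_z \frac{1}{2\alpha}\|z-x\|_2^2+q(z)$ (the unique minimizer). $I$ is the identity on $\mathbb{R}^n$, and juxtaposition of operators denotes composition. "Second-order differentiable" means that $\nabla f$ exists and is Fréchet differentiable on $\mathbb{R}^n$. *)

theory Defs
  imports "HOL-Analysis.Analysis"
begin

definition weakly_convex :: "real \<Rightarrow> ('a::real_normed_vector \<Rightarrow> real) \<Rightarrow> bool" where
  "weakly_convex \<rho> g \<longleftrightarrow> (\<forall>t\<ge>\<rho>. convex_on UNIV (\<lambda>x. g x + t / 2 * (norm x)\<^sup>2))"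

(* Unspecified unless the minimizer exists and is unique. *)
definition prox :: "real \<Rightarrow> ('a::real_normed_vector \<Rightarrow> real) \<Rightarrow> 'a \<Rightarrow> 'a" where
  "prox \<alpha> q x =
    (THE z. is_arg_min (\<lambda>z. 1 / (2 * \<alpha>) * (norm (z - x))\<^sup>2 + q z) (\<lambda>_. True) z)"

(* Unspecified at points where f is not differentiable. *)
definition gradient :: "('a::real_inner \<Rightarrow> real) \<Rightarrow> 'a \<Rightarrow> 'a" where
  "gradient f x = (THE D. GDERIV f x :> D)"

(* The second conjunct is Frechet differentiability of the gradient map; continuity of the
   second derivative is not required. *)
definition second_order_differentiable :: "('a::real_inner \<Rightarrow> real) \<Rightarrow> bool" where
  "second_order_differentiable f \<longleftrightarrow>
    (\<forall>x. \<exists>D. GDERIV f x :> D) \<and> (\<forall>x. gradient f differentiable (at x))"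

definition reflect :: "('a::real_vector \<Rightarrow> 'a) \<Rightarrow> 'a \<Rightarrow> 'a" where
  "reflect J x = 2 *\<^sub>R J x - x"

definition T_op ::
  "real \<Rightarrow> ('a::real_normed_vector \<Rightarrow> real) \<Rightarrow> ('a \<Rightarrow> real) \<Rightarrow> 'a \<Rightarrow> 'a" where
  "T_op \<alpha> f g = reflect (prox \<alpha> f) \<circ> reflect (prox \<alpha> g)"

definition \<beta>\<^sub>1 :: "real \<Rightarrow> real \<Rightarrow> real" where
  "\<beta>\<^sub>1 \<alpha> \<rho> = \<alpha> / (1 + \<alpha> * \<rho>)"

definition \<beta>\<^sub>2 :: "real \<Rightarrow> real \<Rightarrow> real" where
  "\<beta>\<^sub>2 \<alpha> \<rho> = \<alpha> / (1 - \<alpha> * \<rho>)"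

definition K\<^sub>1 :: "real \<Rightarrow> real \<Rightarrow> ('a::real_normed_vector \<Rightarrow> real) \<Rightarrow> 'a \<Rightarrow> 'a" where
  "K\<^sub>1 \<alpha> \<rho> g x = prox (\<beta>\<^sub>1 \<alpha> \<rho>) g ((\<beta>\<^sub>1 \<alpha> \<rho> / \<alpha>) *\<^sub>R x)"

definition K\<^sub>2 :: "real \<Rightarrow> real \<Rightarrow> ('a::real_normed_vector \<Rightarrow> real) \<Rightarrow> 'a \<Rightarrow> 'a" where
  "K\<^sub>2 \<alpha> \<rho> f x = prox (\<beta>\<^sub>2 \<alpha> \<rho>) f ((\<beta>\<^sub>2 \<alpha> \<rho> / \<alpha>) *\<^sub>R x)"

definition V_op ::
  "real \<Rightarrow> real \<Rightarrow> ('a::real_normed_vector \<Rightarrow> real) \<Rightarrow> ('a \<Rightarrow> real) \<Rightarrow> 'a \<Rightarrow> 'a" where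
  "V_op \<alpha> \<rho> f g = reflect (K\<^sub>2 \<alpha> \<rho> f) \<circ> reflect (K\<^sub>1 \<alpha> \<rho> g)"

end

theory Submission
  imports Defs
begin

text \<open>Write \<open>p\<close>, \<open>w\<close> and \<open>q = 2w - p\<close> for the differences of two inputs, of the resolvent values and
  of the reflected points.  On the side of \<open>g\<close>, comparing two strongly convex minimisation problems
  gives \<open>\<langle>w, p\<rangle> \<ge> (1 - c) \<bar>w\<bar>\<^sup>2\<close> with \<open>c = \<alpha>\<rho>\<close> for \<open>T\<close> and \<open>c = 0\<close> for \<open>V\<close>, hence the Lipschitz constant
  \<open>(1 + c) / (1 - c)\<close>.  On the side of \<open>f\<close>, cocoercivity of \<open>\<nabla>f - s I\<close> confines \<open>q\<close> to the ball with
  diameter from \<open>a p\<close> to \<open>b p\<close>, where \<open>a\<close> and \<open>b\<close> are the values of \<open>(1 - t) / (1 + t)\<close> at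
  \<open>t = \<alpha>(s - \<tau>)\<close> and \<open>t = \<alpha>(\<sigma> - \<tau>)\<close>, with \<open>\<tau> = 0\<close> for \<open>T\<close> and \<open>\<tau> = \<rho>\<close> for \<open>V\<close>.  For \<open>T\<close>, the step size
  bound \<open>\<alpha>\<^sup>2\<sigma>s \<le> 1\<close> says exactly that \<open>\<bar>b\<bar> \<le> a\<close>, and the two constants multiply to the claimed one
  because \<open>(1 - \<alpha>s) (1 + \<alpha>\<rho>) = (1 - \<alpha>\<^sup>2s\<rho>) - \<alpha>(s - \<rho>)\<close>.\<close>

section \<open>Minimisers of strongly convex functions\<close>

text \<open>Testing \<open>u\<close> against a point of the segment to \<open>z\<close> leaves a
  factor \<open>1 - c\<close> on both sides. Cancelling it and letting \<open>c\<close> tend to 1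
  gives the full quadratic gap.\<close>

lemma strongly_convex_minimizer_growth:
  fixes F :: "'a::real_inner \<Rightarrow> real"
  assumes cvx: "convex_on UNIV (\<lambda>z. F z - m / 2 * (norm z)\<^sup>2)"
    and min: "\<And>z. F u \<le> F z"
  shows "F u + m / 2 * (norm (z - u))\<^sup>2 \<le> F z"
proof -
  have "c * (m / 2 * (norm (z - u))\<^sup>2) \<le> F z - F u" if c: "0 < c" "c < 1" for c
  proof -
    define y where "y = c *\<^sub>R u + (1 - c) *\<^sub>R z"
    have cvx_y: "F y - m / 2 * (norm y)\<^sup>2
        \<le> c * (F u - m / 2 * (norm u)\<^sup>2) + (1 - c) * (F z - m / 2 * (norm z)\<^sup>2)"
      using cvx c unfolding convex_on_def y_def by force
    have norm_y: "(norm y)\<^sup>2 = c * (norm u)\<^sup>2 + (1 - c) * (norm z)\<^sup>2 - c * (1 - c) * (norm (z - u))\<^sup>2"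
      unfolding y_def power2_norm_eq_inner
      by (simp add: inner_simps inner_commute algebra_simps power2_eq_square)
    have "F y \<le> c * F u + (1 - c) * F z - m / 2 * (c * (1 - c) * (norm (z - u))\<^sup>2)"
      using cvx_y unfolding norm_y by (simp add: field_simps)
    with min[of y] have "(1 - c) * (c * (m / 2 * (norm (z - u))\<^sup>2)) \<le> (1 - c) * (F z - F u)"
      by (simp add: field_simps)
    with c show ?thesis by simp
  qed
  \<comment> \<open>This rule performs the limit \<open>c\<close> to 1.\<close>
  from field_le_mult_one_interval[OF this] show ?thesis by simp
qed

text \<open>The convex part \<open>h\<close> is continuous and decreases at most linearly, so the
  quadratic term dominates far out and a minimum over a large ball is global.\<close>

lemma strongly_convex_minimizer_exists:
  fixes F :: "'a::euclidean_space \<Rightarrow> real"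
  assumes m: "m > 0" and cvx: "convex_on UNIV (\<lambda>z. F z - m / 2 * (norm z)\<^sup>2)"
  obtains u where "\<And>z. F u \<le> F z"
proof -
  define h where "h = (\<lambda>z. F z - m / 2 * (norm z)\<^sup>2)"
  have cvx_h: "convex_on UNIV h" using cvx by (simp add: h_def)
  have cont_h: "continuous_on UNIV h"
    using convex_on_continuous[OF open_UNIV cvx_h] .
  have F: "F = (\<lambda>z. h z + m / 2 * (norm z)\<^sup>2)" by (simp add: h_def)
  have cont_F: "continuous_on A F" for A
    unfolding F using continuous_on_subset[OF cont_h] by (intro continuous_intros) auto
  have "compact (h ` sphere 0 1)"
    by (intro compact_continuous_image continuous_on_subset[OF cont_h]) auto
  from compact_imp_bounded[OF this] obtain B where "\<forall>y\<in>h ` sphere 0 1. \<bar>y\<bar> \<le> B"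
    unfolding bounded_real by blast
  then have B: "\<bar>h y\<bar> \<le> B" if "norm y = 1" for y using that by simp
  define C where "C = \<bar>B\<bar> + \<bar>h 0\<bar>"
  \<comment> \<open>The point \<open>z / norm z\<close> lies on the segment from 0 to
    \<open>z\<close>, so convexity carries the bound on the unit sphere outwards as a linear
    one.\<close>
  have lower: "h 0 - C * norm z \<le> h z" if z: "norm z \<ge> 1" for z
  proof -
    define r where "r = norm z"
    have r: "r \<ge> 1" using z by (simp add: r_def)
    have "h ((1 - 1 / r) *\<^sub>R 0 + (1 / r) *\<^sub>R z) \<le> (1 - 1 / r) * h 0 + (1 / r) * h z"
      using convex_onD[OF cvx_h, of "1 / r" 0 z] r by simp
    then have "r * h ((1 / r) *\<^sub>R z) \<le> (r - 1) * h 0 + h z"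
      using r by (simp add: field_simps)
    moreover have "norm ((1 / r) *\<^sub>R z) = 1" using r by (auto simp: r_def)
    from B[OF this] have "h 0 - C \<le> h ((1 / r) *\<^sub>R z)" by (auto simp: C_def)
    then have "r * (h 0 - C) \<le> r * h ((1 / r) *\<^sub>R z)"
      using r by (intro mult_left_mono) auto
    ultimately show ?thesis unfolding r_def[symmetric] by (simp add: algebra_simps)
  qed
  \<comment> \<open>Beyond \<open>2 * C / m\<close> the term \<open>m / 2 * (norm z)\<^sup>2\<close>
    outweighs \<open>C * norm z\<close>; the 1 keeps \<open>z\<close> in the range of
    \<open>lower\<close>.\<close>
  define R where "R = max 1 (2 * C / m)"
  have far: "F 0 \<le> F z" if "norm z \<ge> R" for z
  proof -
    have z: "norm z \<ge> 1" "norm z \<ge> 2 * C / m" using that by (auto simp: R_def)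
    have "C \<le> m / 2 * norm z" using z(2) m by (simp add: field_simps)
    then have "C * norm z \<le> m / 2 * norm z * norm z" by (intro mult_right_mono) auto
    then show ?thesis using lower[OF z(1)] by (simp add: F power2_eq_square)
  qed
  have "R \<ge> 0" by (simp add: R_def)
  then have "\<exists>u\<in>cball 0 R. \<forall>z\<in>cball 0 R. F u \<le> F z"
    by (intro continuous_attains_inf cont_F) auto
  then obtain u where u: "\<And>z. norm z \<le> R \<Longrightarrow> F u \<le> F z" by (metis mem_cball_0)
  have "F u \<le> F z" for z
    using u[of z] u[of 0] far[of z] \<open>R \<ge> 0\<close> by (cases "norm z \<le> R") auto
  then show ?thesis using that by blast
qed

section \<open>Proximity operators\<close>

text \<open>Expanding the square leaves the assumed convex function plus an affine one. Here
  \<open>r\<close> may be negative: \<open>\<rho>\<close> serves for \<open>g\<close> and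
  \<open>- s\<close> for \<open>f\<close>.\<close>

lemma convex_on_prox_objective:
  fixes q :: "'a::real_inner \<Rightarrow> real"
  assumes "convex_on UNIV (\<lambda>z. q z + r / 2 * (norm z)\<^sup>2)"
  shows "convex_on UNIV
    (\<lambda>z. (1 / (2 * \<alpha>) * (norm (z - x))\<^sup>2 + q z) - (1 / \<alpha> - r) / 2 * (norm z)\<^sup>2)"
proof -
  have aff: "convex_on UNIV (\<lambda>z. (norm x)\<^sup>2 / (2 * \<alpha>) - (z \<bullet> x) / \<alpha>)"
    by (rule convex_onI) (simp_all add: inner_simps field_simps add_divide_distrib diff_divide_distrib)
  have "(1 / (2 * \<alpha>) * (norm (z - x))\<^sup>2 + q z) - (1 / \<alpha> - r) / 2 * (norm z)\<^sup>2
      = (q z + r / 2 * (norm z)\<^sup>2) + ((norm x)\<^sup>2 / (2 * \<alpha>) - (z \<bullet> x) / \<alpha>)" for z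
  proof -
    have norm: "(norm (z - x))\<^sup>2 = (norm z)\<^sup>2 - 2 * (z \<bullet> x) + (norm x)\<^sup>2"
      unfolding power2_norm_eq_inner by (simp add: inner_diff inner_commute)
    show ?thesis
      unfolding norm by (simp add: algebra_simps add_divide_distrib diff_divide_distrib)
  qed
  then show ?thesis using convex_on_add[OF assms aff] by presburger
qed

text \<open>For \<open>r < 1 / \<alpha>\<close> the objective is strongly convex, so a minimiser
  exists, the growth bound makes it unique, and the description in \<open>prox\<close> denotes
  it.\<close>

lemma prox_growth:
  fixes q :: "'a::euclidean_space \<Rightarrow> real"
  assumes cvx: "convex_on UNIV (\<lambda>z. q z + r / 2 * (norm z)\<^sup>2)" and r: "r < 1 / \<alpha>"
  defines "F \<equiv> \<lambda>x z. 1 / (2 * \<alpha>) * (norm (z - x))\<^sup>2 + q z"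
  shows "F x (prox \<alpha> q x) + (1 / \<alpha> - r) / 2 * (norm (z - prox \<alpha> q x))\<^sup>2 \<le> F x z"
proof -
  have cvxF: "convex_on UNIV (\<lambda>z. F x z - (1 / \<alpha> - r) / 2 * (norm z)\<^sup>2)"
    unfolding F_def by (rule convex_on_prox_objective[OF cvx])
  obtain u where u: "\<And>z. F x u \<le> F x z"
    using strongly_convex_minimizer_exists[OF _ cvxF] r by auto
  note growth = strongly_convex_minimizer_growth[OF cvxF]
  have "prox \<alpha> q x = (THE v. is_arg_min (F x) (\<lambda>_. True) v)"
    by (simp add: prox_def F_def)
  also have "\<dots> = u"
    unfolding is_arg_min_def
  proof (rule the_equality)
    show "True \<and> \<not> (\<exists>y. True \<and> F x y < F x u)" using u by (auto simp: not_less)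
  next
    fix v assume "True \<and> \<not> (\<exists>y. True \<and> F x y < F x v)"
    then have "F x v \<le> F x u" by (auto simp: not_less)
    with growth[OF u, of v] have "(1 / \<alpha> - r) / 2 * (norm (v - u))\<^sup>2 \<le> 0" by linarith
    with r show "v = u" by (simp add: mult_le_0_iff)
  qed
  finally have "prox \<alpha> q x = u" .
  with growth[OF u] show ?thesis by simp
qed

text \<open>In the sum of the growth bounds for \<open>x\<close> tested at \<open>J y\<close> and
  for \<open>y\<close> tested at \<open>J x\<close> the values of \<open>q\<close> cancel; the
  remaining squared norms combine to an inner product.\<close>

lemma prox_inner_ge:
  fixes q :: "'a::euclidean_space \<Rightarrow> real"
  assumes cvx: "convex_on UNIV (\<lambda>z. q z + r / 2 * (norm z)\<^sup>2)" and r: "r < 1 / \<alpha>" and "\<alpha> > 0"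
  defines "J \<equiv> prox \<alpha> q"
  shows "(1 - \<alpha> * r) * (norm (J x - J y))\<^sup>2 \<le> (J x - J y) \<bullet> (x - y)"
proof -
  define N where "N = (\<lambda>z w::'a. (norm (z - w))\<^sup>2)"
  have "1 / (2 * \<alpha>) * N (J x) x + 1 / (2 * \<alpha>) * N (J y) y + (1 / \<alpha> - r) * N (J x) (J y)
      \<le> 1 / (2 * \<alpha>) * N (J y) x + 1 / (2 * \<alpha>) * N (J x) y"
    using prox_growth[OF cvx r, of x "J y"] prox_growth[OF cvx r, of y "J x"]
    by (simp add: J_def N_def norm_minus_commute[of "prox \<alpha> q y" "prox \<alpha> q x"])
  from mult_left_mono[OF this, of "2 * \<alpha>"]
  have "2 * (1 - \<alpha> * r) * N (J x) (J y) \<le> N (J y) x + N (J x) y - N (J x) x - N (J y) y"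
    using \<open>\<alpha> > 0\<close> by (simp add: algebra_simps)
  also have "\<dots> = 2 * ((J x - J y) \<bullet> (x - y))"
    unfolding N_def power2_norm_eq_inner by (simp add: inner_simps inner_commute)
  finally show ?thesis by (simp add: N_def algebra_simps)
qed

lemma GDERIV_prox_eq:
  fixes f :: "'a::euclidean_space \<Rightarrow> real"
  assumes cvx: "convex_on UNIV (\<lambda>z. f z + r / 2 * (norm z)\<^sup>2)" and r: "r < 1 / \<alpha>" and "\<alpha> > 0"
    and D: "GDERIV f (prox \<alpha> f x) :> D"
  shows "\<alpha> *\<^sub>R D = x - prox \<alpha> f x"
proof -
  define u where "u = prox \<alpha> f x"
  define F where "F = (\<lambda>z. 1 / (2 * \<alpha>) * ((z - x) \<bullet> (z - x)) + f z)"
  \<comment> \<open>\<open>E\<close> is the gradient of the prox objective at its minimiser, so it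
    must vanish.\<close>
  define E where "E = (1 / \<alpha>) *\<^sub>R (u - x) + D"
  have Fu: "F u \<le> F z" for z
  proof -
    have "F u + (1 / \<alpha> - r) / 2 * (norm (z - u))\<^sup>2 \<le> F z"
      using prox_growth[OF cvx r, of x z] by (simp add: F_def u_def power2_norm_eq_inner)
    moreover have "0 \<le> (1 / \<alpha> - r) / 2 * (norm (z - u))\<^sup>2" using r by simp
    ultimately show ?thesis by linarith
  qed
  have "(f has_derivative (\<lambda>h. h \<bullet> D)) (at u)" using D by (simp add: gderiv_def u_def)
  then have "(F has_derivative (\<lambda>h. h \<bullet> E)) (at u)"
    unfolding F_def E_def using \<open>\<alpha> > 0\<close>
    by (auto intro!: derivative_eq_intros simp: inner_simps inner_commute field_simps)
  then have "(\<lambda>h. h \<bullet> E) = (\<lambda>h. 0)"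
    using Fu by (intro differential_zero_maxmin[of u UNIV F]) auto
  then have "E \<bullet> E = 0" by metis
  then have "\<alpha> *\<^sub>R E = 0" by simp
  then show ?thesis using \<open>\<alpha> > 0\<close> by (simp add: E_def u_def algebra_simps)
qed

section \<open>Gradients of smooth strongly convex functions\<close>

lemma GDERIV_along_line:
  assumes "GDERIV f (x + t *\<^sub>R d) :> D"
  shows "((\<lambda>t. f (x + t *\<^sub>R d)) has_real_derivative D \<bullet> d) (at t)"
proof -
  have "((\<lambda>t. x + t *\<^sub>R d) has_derivative (\<lambda>h. h *\<^sub>R d)) (at t)"
    by (auto intro!: derivative_eq_intros)
  from has_derivative_compose[OF this assms[unfolded gderiv_def]]
  have "((\<lambda>t. f (x + t *\<^sub>R d)) has_derivative (\<lambda>h. (h *\<^sub>R d) \<bullet> D)) (at t)" .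
  also have "(\<lambda>h. (h *\<^sub>R d) \<bullet> D) = (*) (D \<bullet> d)"
    by (simp add: fun_eq_iff inner_commute)
  finally show ?thesis by (simp add: has_field_derivative_def)
qed

text \<open>Restriction to the line through \<open>x\<close> and \<open>y\<close> reduces this to
  the tangent bound for one real variable.\<close>

lemma convex_on_GDERIV_above_tangent:
  fixes h :: "'a::real_inner \<Rightarrow> real"
  assumes cvx: "convex_on UNIV h" and D: "GDERIV h x :> D"
  shows "h x + D \<bullet> (y - x) \<le> h y"
proof -
  define \<phi> where "\<phi> = (\<lambda>t. h (x + t *\<^sub>R (y - x)))"
  have "convex_on UNIV \<phi>"
  proof (rule convex_onI)
    fix t a b :: real assume "0 < t" "t < 1"
    moreover have "x + ((1 - t) *\<^sub>R a + t *\<^sub>R b) *\<^sub>R (y - x)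
        = (1 - t) *\<^sub>R (x + a *\<^sub>R (y - x)) + t *\<^sub>R (x + b *\<^sub>R (y - x))"
      by (simp add: algebra_simps)
    ultimately show "\<phi> ((1 - t) *\<^sub>R a + t *\<^sub>R b) \<le> (1 - t) * \<phi> a + t * \<phi> b"
      unfolding \<phi>_def by (auto intro!: convex_onD[OF cvx])
  qed simp
  moreover have "(\<phi> has_real_derivative D \<bullet> (y - x)) (at 0)"
    unfolding \<phi>_def by (rule GDERIV_along_line) (simp add: D)
  ultimately have "\<phi> 1 - \<phi> 0 \<ge> D \<bullet> (y - x) * (1 - 0)"
    by (intro convex_on_imp_above_tangent[where A = UNIV]) auto
  then show ?thesis by (simp add: \<phi>_def)
qed

lemma Lipschitz_gradient_descent:
  fixes f :: "'a::real_inner \<Rightarrow> real"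
  assumes D: "\<And>x. GDERIV f x :> D x"
    and lip: "\<And>x y. norm (D x - D y) \<le> \<sigma> * norm (x - y)"
  shows "f y \<le> f x + D x \<bullet> (y - x) + \<sigma> / 2 * (norm (y - x))\<^sup>2"
proof -
  define d where "d = y - x"
  \<comment> \<open>The gap between \<open>f\<close> and its quadratic upper model along the
    segment; by Cauchy-Schwarz its derivative is at most 0.\<close>
  define \<psi> where "\<psi> = (\<lambda>t. f (x + t *\<^sub>R d) - t * (D x \<bullet> d) - \<sigma> / 2 * t\<^sup>2 * (norm d)\<^sup>2)"
  have "\<psi> 1 \<le> \<psi> 0"
  proof (rule DERIV_nonpos_imp_nonincreasing[of 0 1 \<psi>])
    fix t :: real assume t: "0 \<le> t" "t \<le> 1"
    have "(\<psi> has_real_derivative D (x + t *\<^sub>R d) \<bullet> d - D x \<bullet> d - \<sigma> * t * (norm d)\<^sup>2) (at t)"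
      unfolding \<psi>_def by (auto intro!: derivative_eq_intros GDERIV_along_line D)
    moreover have "D (x + t *\<^sub>R d) \<bullet> d - D x \<bullet> d \<le> \<sigma> * t * (norm d)\<^sup>2"
    proof -
      have "(D (x + t *\<^sub>R d) - D x) \<bullet> d \<le> norm (D (x + t *\<^sub>R d) - D x) * norm d"
        by (rule norm_cauchy_schwarz)
      also have "\<dots> \<le> \<sigma> * norm (x + t *\<^sub>R d - x) * norm d"
        by (intro mult_right_mono lip) auto
      finally show ?thesis using t by (simp add: inner_diff_left power2_eq_square mult.assoc)
    qed
    ultimately show "\<exists>z. (\<psi> has_real_derivative z) (at t) \<and> z \<le> 0" by force
  qed simp
  then show ?thesis by (simp add: \<psi>_def d_def)
qed

locale smooth_strongly_convex =
  fixes f :: "'a::euclidean_space \<Rightarrow> real" and D :: "'a \<Rightarrow> 'a" and s \<sigma> :: real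
  assumes gderiv: "\<And>x. GDERIV f x :> D x"
    and lipschitz: "\<And>x y. norm (D x - D y) \<le> \<sigma> * norm (x - y)"
    and convex: "convex_on UNIV (\<lambda>x. f x - s / 2 * (norm x)\<^sup>2)"
begin

lemma tangent_below:
  "f x + D x \<bullet> (y - x) + s / 2 * (norm (y - x))\<^sup>2 \<le> f y"
proof -
  have "((\<lambda>x. f x - s / 2 * (norm x)\<^sup>2) has_derivative (\<lambda>h. h \<bullet> (D x - s *\<^sub>R x))) (at x)"
    using gderiv[of x] unfolding gderiv_def power2_norm_eq_inner
    by (auto intro!: derivative_eq_intros simp: inner_simps inner_commute)
  then have "GDERIV (\<lambda>x. f x - s / 2 * (norm x)\<^sup>2) x :> D x - s *\<^sub>R x" by (simp add: gderiv_def)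
  from convex_on_GDERIV_above_tangent[OF convex this, of y] show ?thesis
    unfolding power2_norm_eq_inner by (simp add: inner_simps inner_commute algebra_simps)
qed

lemmas descent = Lipschitz_gradient_descent[OF gderiv lipschitz]

text \<open>At a unit vector the lower and upper quadratic models of \<open>f\<close> around 0
  differ only in \<open>s / 2\<close> and \<open>\<sigma> / 2\<close>.\<close>

lemma modulus_le: "s \<le> \<sigma>"
proof -
  obtain b :: 'a where b: "b \<in> Basis" using nonempty_Basis by blast
  then have "norm b = 1" by simp
  with tangent_below[of 0 b] descent[of b 0] show ?thesis by simp
qed

text \<open>The Baillon-Haddad argument for f - s/2 |x|^2, whose gradient difference is
  \<open>G\<close>: the second factor equals \<open>L *\<^sub>R (x - y) - G\<close>, so the claim is
  |G|^2 \<le> L <G, x - y>.\<close>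

lemma cocoercive:
  "0 \<le> (D x - D y - s *\<^sub>R (x - y)) \<bullet> (\<sigma> *\<^sub>R (x - y) - (D x - D y))"
proof -
  define L where "L = \<sigma> - s"
  define G where "G = D x - D y - s *\<^sub>R (x - y)"
  have key: "(2 * t - L * t\<^sup>2) * (G \<bullet> G) \<le> G \<bullet> (x - y)" for t
  proof -
    \<comment> \<open>\<open>h'\<close> is the Bregman distance of f - s/2 |x|^2 from
      \<open>b\<close> to \<open>a\<close>. It is bounded below by comparing, after a gradient step
      from \<open>a\<close>, the lower model at \<open>b\<close> with the upper model at
      \<open>a\<close>.\<close>
    have half: "h' + L * t\<^sup>2 / 2 * (G' \<bullet> G') - t * (G' \<bullet> G') \<ge> 0"
      if "G' = D a - D b - s *\<^sub>R (a - b)"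
        and "h' = f a - f b - D b \<bullet> (a - b) - s / 2 * (norm (a - b))\<^sup>2" for a b G' h'
    proof -
      define z where "z = a - t *\<^sub>R G'"
      have za: "z - a = - (t *\<^sub>R G')" "z - b = (a - b) - t *\<^sub>R G'" by (simp_all add: z_def)
      have "f b + D b \<bullet> (z - b) + s / 2 * (norm (z - b))\<^sup>2
          \<le> f a + D a \<bullet> (z - a) + \<sigma> / 2 * (norm (z - a))\<^sup>2"
        using tangent_below[of b z] descent[of z a] by linarith
      moreover have "D a = G' + D b + s *\<^sub>R (a - b)" by (simp add: that(1))
      then have "t * (D a \<bullet> G') = t * (G' \<bullet> G' + D b \<bullet> G' + s * ((a - b) \<bullet> G'))"
        by (simp add: inner_simps)
      ultimately show ?thesis
        unfolding za that(2) L_def power2_norm_eq_inner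
        by (simp add: inner_simps inner_commute algebra_simps power2_eq_square
            add_divide_distrib diff_divide_distrib)
    qed
    define h\<^sub>1 where "h\<^sub>1 = f x - f y - D y \<bullet> (x - y) - s / 2 * (norm (x - y))\<^sup>2"
    define h\<^sub>2 where "h\<^sub>2 = f y - f x - D x \<bullet> (y - x) - s / 2 * (norm (y - x))\<^sup>2"
    \<comment> \<open>Symmetrising the Bregman distance removes the function values.\<close>
    have "G \<bullet> (x - y) = h\<^sub>1 + h\<^sub>2"
      unfolding G_def h\<^sub>1_def h\<^sub>2_def power2_norm_eq_inner
      by (simp add: inner_simps inner_commute algebra_simps)
    moreover have "- G = D y - D x - s *\<^sub>R (y - x)" by (simp add: G_def algebra_simps)
    from half[OF this h\<^sub>2_def] have "h\<^sub>2 + L * t\<^sup>2 / 2 * (G \<bullet> G) - t * (G \<bullet> G) \<ge> 0"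
      by (simp only: inner_minus_left inner_minus_right minus_minus)
    ultimately show ?thesis
      using half[OF G_def h\<^sub>1_def] by (simp add: left_diff_distrib)
  qed
  have "G \<bullet> G \<le> L * (G \<bullet> (x - y))"
  proof (cases "L = 0")
    case True
    have "G \<bullet> G = 0"
    proof (rule ccontr)
      assume "G \<bullet> G \<noteq> 0"
      \<comment> \<open>With \<open>L = 0\<close> the left side of \<open>key\<close> is linear in
        \<open>t\<close>; this \<open>t\<close> makes it exceed the right side.\<close>
      with key[of "(\<bar>G \<bullet> (x - y)\<bar> + 1) / (2 * (G \<bullet> G))"] True show False by simp
    qed
    with True show ?thesis by simp
  next
    case False
    with modulus_le have "L > 0" by (simp add: L_def)
    \<comment> \<open>This \<open>t\<close> maximises \<open>2 * t - L * t\<^sup>2\<close>.\<close>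
    with key[of "1 / L"] show ?thesis by (simp add: field_simps power2_eq_square)
  qed
  moreover have "\<sigma> *\<^sub>R (x - y) - (D x - D y) = L *\<^sub>R (x - y) - G"
    by (simp add: G_def L_def algebra_simps)
  ultimately show ?thesis
    unfolding G_def[symmetric]
    by (simp only: inner_diff_right[of G "L *\<^sub>R (x - y)"] inner_scaleR_right)
qed

end

section \<open>Lipschitz constants of the reflected operators\<close>

lemma reflect_diff: "reflect J x - reflect J y = 2 *\<^sub>R (J x - J y) - (x - y)"
  by (simp add: reflect_def algebra_simps)

text \<open>Expanding the square bounds it by |p|^2 + 4c |w|^2, and Cauchy-Schwarz gives |w| \<le>
  |p| / (1 - c). The constant then follows from (1 - c)^2 + 4c = (1 + c)^2.\<close>

lemma norm_reflect_le:
  fixes w p :: "'a::real_inner"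
  assumes c: "0 \<le> c" "c < 1" and wp: "(1 - c) * (norm w)\<^sup>2 \<le> w \<bullet> p"
  shows "norm (2 *\<^sub>R w - p) \<le> (1 + c) / (1 - c) * norm p"
proof (rule power2_le_imp_le)
  have "(1 - c) * (norm w)\<^sup>2 \<le> norm w * norm p"
    using wp norm_cauchy_schwarz[of w p] by linarith
  then have "norm w * ((1 - c) * norm w) \<le> norm w * norm p"
    by (simp add: power2_eq_square ac_simps)
  then have "(1 - c) * norm w \<le> norm p"
    by (cases "w = 0") (simp_all add: mult_le_cancel_left)
  then have "norm w \<le> norm p / (1 - c)" using c by (simp add: field_simps)
  then have "(norm w)\<^sup>2 \<le> (norm p / (1 - c))\<^sup>2" by (intro power_mono) auto
  then have "4 * c * (norm w)\<^sup>2 \<le> 4 * c * (norm p / (1 - c))\<^sup>2" using c by (intro mult_left_mono) auto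
  moreover have "(norm (2 *\<^sub>R w - p))\<^sup>2 = 4 * (norm w)\<^sup>2 - 4 * (w \<bullet> p) + (norm p)\<^sup>2"
    unfolding power2_norm_eq_inner by (simp add: inner_simps inner_commute)
  ultimately have "(norm (2 *\<^sub>R w - p))\<^sup>2 \<le> (norm p)\<^sup>2 + 4 * c * (norm p / (1 - c))\<^sup>2"
    using wp by (simp add: algebra_simps)
  also have "\<dots> = ((1 + c) / (1 - c) * norm p)\<^sup>2"
  proof -
    have "((1 + c) / (1 - c))\<^sup>2 = ((1 - c)\<^sup>2 + 4 * c) / (1 - c)\<^sup>2"
      by (simp add: power_divide power2_eq_square algebra_simps)
    also have "\<dots> = 1 + 4 * c / (1 - c)\<^sup>2" using c by (simp add: add_divide_distrib)
    finally show ?thesis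
      unfolding power_mult_distrib power_divide by (simp add: distrib_right)
  qed
  finally show "(norm (2 *\<^sub>R w - p))\<^sup>2 \<le> ((1 + c) / (1 - c) * norm p)\<^sup>2" .
qed (use c in simp)

text \<open>By Thales, \<open>q\<close> lies in the ball with diameter from
  \<open>a *\<^sub>R p\<close> to \<open>b *\<^sub>R p\<close>; the norm of the centre plus the
  radius gives the maximum.\<close>

lemma norm_le_of_diameter:
  fixes p q :: "'a::real_inner"
  assumes "(q - a *\<^sub>R p) \<bullet> (q - b *\<^sub>R p) \<le> 0"
  shows "norm q \<le> max \<bar>a\<bar> \<bar>b\<bar> * norm p"
proof -
  have "(norm (q - ((a + b) / 2) *\<^sub>R p))\<^sup>2
      = (q - a *\<^sub>R p) \<bullet> (q - b *\<^sub>R p) + (\<bar>(a - b) / 2\<bar> * norm p)\<^sup>2"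
    unfolding power_mult_distrib power2_norm_eq_inner
    by (simp add: inner_simps inner_commute field_simps power2_eq_square)
  then have "(norm (q - ((a + b) / 2) *\<^sub>R p))\<^sup>2 \<le> (\<bar>(a - b) / 2\<bar> * norm p)\<^sup>2"
    using assms by linarith
  then have "norm (q - ((a + b) / 2) *\<^sub>R p) \<le> \<bar>(a - b) / 2\<bar> * norm p"
    by (rule power2_le_imp_le) simp
  moreover have "norm q \<le> norm (q - ((a + b) / 2) *\<^sub>R p) + \<bar>(a + b) / 2\<bar> * norm p"
    using norm_triangle_sub[of q "((a + b) / 2) *\<^sub>R p"] by (simp add: add.commute)
  ultimately have "norm q \<le> (\<bar>(a - b) / 2\<bar> + \<bar>(a + b) / 2\<bar>) * norm p"
    unfolding distrib_right by linarith
  also have "\<bar>(a - b) / 2\<bar> + \<bar>(a + b) / 2\<bar> = max \<bar>a\<bar> \<bar>b\<bar>"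
    unfolding max_def abs_if by (auto simp: field_simps)
  finally show ?thesis .
qed

lemma K\<^sub>1_zero: "\<alpha> > 0 \<Longrightarrow> K\<^sub>1 \<alpha> 0 g = prox \<alpha> g"
  and K\<^sub>2_zero: "\<alpha> > 0 \<Longrightarrow> K\<^sub>2 \<alpha> 0 f = prox \<alpha> f"
  by (simp_all add: K\<^sub>1_def K\<^sub>2_def \<beta>\<^sub>1_def \<beta>\<^sub>2_def fun_eq_iff)

text \<open>\<open>K\<^sub>1 \<alpha> \<tau> g\<close> is the proximity operator of \<open>g + \<tau>/2 \<bar>x\<bar>\<^sup>2\<close>, and \<open>K\<^sub>2 \<alpha> \<tau> f\<close> that of \<open>f - \<tau>/2 \<bar>x\<bar>\<^sup>2\<close>,
  so \<open>\<tau> = 0\<close> covers \<open>T\<close> and \<open>\<tau> = \<rho>\<close> covers \<open>V\<close>.\<close>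

lemma reflect_K\<^sub>1_Lipschitz:
  fixes g :: "'a::euclidean_space \<Rightarrow> real"
  assumes cvx: "convex_on UNIV (\<lambda>z. g z + \<rho> / 2 * (norm z)\<^sup>2)"
    and "\<alpha> > 0" "0 \<le> \<tau>" "\<tau> \<le> \<rho>" "\<alpha> * (\<rho> - \<tau>) < 1"
  shows "norm (reflect (K\<^sub>1 \<alpha> \<tau> g) x - reflect (K\<^sub>1 \<alpha> \<tau> g) y)
    \<le> (1 + \<alpha> * (\<rho> - \<tau>)) / (1 - \<alpha> * (\<rho> - \<tau>)) * norm (x - y)"
proof -
  define k where "k = 1 + \<alpha> * \<tau>"
  define w where "w = K\<^sub>1 \<alpha> \<tau> g x - K\<^sub>1 \<alpha> \<tau> g y"
  have k: "k > 0" using assms by (simp add: k_def add_pos_nonneg)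
  have \<beta>: "\<beta>\<^sub>1 \<alpha> \<tau> = \<alpha> / k" by (simp add: \<beta>\<^sub>1_def k_def)
  have K: "K\<^sub>1 \<alpha> \<tau> g x = prox (\<alpha> / k) g ((1 / k) *\<^sub>R x)" for x
    using \<open>\<alpha> > 0\<close> by (simp add: K\<^sub>1_def \<beta>)
  have "\<rho> < 1 / (\<alpha> / k)" using assms k by (simp add: k_def field_simps)
  from prox_inner_ge[OF cvx this, of "(1 / k) *\<^sub>R x" "(1 / k) *\<^sub>R y"]
  have "(1 - \<alpha> / k * \<rho>) * (norm w)\<^sup>2 \<le> w \<bullet> ((1 / k) *\<^sub>R (x - y))"
    using \<open>\<alpha> > 0\<close> k by (simp add: w_def K scaleR_diff_right)
  \<comment> \<open>Multiplying by \<open>k\<close> undoes the rescaling of the input and turns the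
    modulus into 1 - \<alpha>(\<rho> - \<tau>).\<close>
  from mult_left_mono[OF this, of k]
  have "k * (1 - \<alpha> / k * \<rho>) * (norm w)\<^sup>2 \<le> w \<bullet> (x - y)"
    using k by (simp only: inner_scaleR_right) simp
  also have "k * (1 - \<alpha> / k * \<rho>) = k - \<alpha> * \<rho>" using k by (simp add: right_diff_distrib)
  finally have "(1 - \<alpha> * (\<rho> - \<tau>)) * (norm w)\<^sup>2 \<le> w \<bullet> (x - y)"
    by (simp add: k_def algebra_simps)
  from norm_reflect_le[OF _ _ this] show ?thesis
    using assms by (simp add: reflect_diff w_def)
qed

lemma (in smooth_strongly_convex) reflect_K\<^sub>2_Lipschitz:
  assumes "\<alpha> > 0" "\<alpha> * \<tau> < 1" "\<tau> < s"
  shows "norm (reflect (K\<^sub>2 \<alpha> \<tau> f) x - reflect (K\<^sub>2 \<alpha> \<tau> f) y)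
    \<le> max (\<bar>1 - \<alpha> * (\<sigma> - \<tau>)\<bar> / (1 + \<alpha> * (\<sigma> - \<tau>))) (\<bar>1 - \<alpha> * (s - \<tau>)\<bar> / (1 + \<alpha> * (s - \<tau>)))
      * norm (x - y)"
proof -
  define k where "k = 1 - \<alpha> * \<tau>"
  define u where "u = K\<^sub>2 \<alpha> \<tau> f"
  define w where "w = u x - u y"
  \<comment> \<open>With this \<open>e\<close> the input difference is \<open>w + e\<close> and the
    reflected difference is \<open>w - e\<close>.\<close>
  define e where "e = \<alpha> *\<^sub>R (D (u x) - D (u y) - \<tau> *\<^sub>R w)"
  define c where "c = \<alpha> * (s - \<tau>)"
  define d where "d = \<alpha> * (\<sigma> - \<tau>)"
  have k: "k > 0" using assms by (simp add: k_def)
  have c: "c > 0" and d: "d > 0" using assms modulus_le by (simp_all add: c_def d_def)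
  have \<beta>: "\<beta>\<^sub>2 \<alpha> \<tau> = \<alpha> / k" by (simp add: \<beta>\<^sub>2_def k_def)
  have u: "u x = prox (\<alpha> / k) f ((1 / k) *\<^sub>R x)" for x
    using \<open>\<alpha> > 0\<close> by (simp add: u_def K\<^sub>2_def \<beta>)
  \<comment> \<open>The optimality condition with step \<alpha> for f - \<tau>/2 |x|^2, obtained
    from the rescaled prox of \<open>f\<close> by multiplying with \<open>k\<close>.\<close>
  have opt: "x = u x + \<alpha> *\<^sub>R (D (u x) - \<tau> *\<^sub>R u x)" for x
  proof -
    have "\<alpha> * \<tau> < \<alpha> * s" using assms by simp
    then have "- s * \<alpha> < k" unfolding k_def by (simp add: mult.commute)
    then have "- s < 1 / (\<alpha> / k)" using assms by (simp add: field_simps)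
    moreover have "convex_on UNIV (\<lambda>z. f z + - s / 2 * (norm z)\<^sup>2)" using convex by simp
    ultimately have "(\<alpha> / k) *\<^sub>R D (u x) = (1 / k) *\<^sub>R x - u x"
      unfolding u using assms k gderiv by (intro GDERIV_prox_eq[where r = "- s"]) auto
    then have "k *\<^sub>R ((\<alpha> / k) *\<^sub>R D (u x)) = k *\<^sub>R ((1 / k) *\<^sub>R x - u x)" by simp
    then have "\<alpha> *\<^sub>R D (u x) = x - k *\<^sub>R u x" using k by (simp add: scaleR_diff_right)
    then show ?thesis by (simp add: k_def algebra_simps)
  qed
  have p: "x - y = w + e"
    using arg_cong2[where f = minus, OF opt[of x] opt[of y]]
    by (simp add: e_def w_def algebra_simps)
  \<comment> \<open>Scaled by \<alpha>^2, cocoercivity places \<open>e\<close> in the ball with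
    diameter from \<open>c *\<^sub>R w\<close> to \<open>d *\<^sub>R w\<close>.\<close>
  have "0 \<le> \<alpha> * \<alpha> * ((D (u x) - D (u y) - s *\<^sub>R w) \<bullet> (\<sigma> *\<^sub>R w - (D (u x) - D (u y))))"
    using cocoercive[of "u x" "u y"] assms unfolding w_def by simp
  also have "\<dots> = (e - c *\<^sub>R w) \<bullet> (d *\<^sub>R w - e)"
  proof -
    have "e - c *\<^sub>R w = \<alpha> *\<^sub>R (D (u x) - D (u y) - s *\<^sub>R w)"
      "d *\<^sub>R w - e = \<alpha> *\<^sub>R (\<sigma> *\<^sub>R w - (D (u x) - D (u y)))"
      by (simp_all add: e_def c_def d_def algebra_simps)
    then show ?thesis by simp
  qed
  finally have ew: "0 \<le> (e - c *\<^sub>R w) \<bullet> (d *\<^sub>R w - e)" .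
  \<comment> \<open>If \<open>e = t *\<^sub>R w\<close>, then \<open>w - e\<close> is
    \<open>(1 - t) / (1 + t)\<close> times \<open>w + e\<close>. The identity measures the deviation
    from this case and so carries the ball for \<open>e\<close> over to
    \<open>w - e\<close>.\<close>
  have ball: "(w - e) - ((1 - t) / (1 + t)) *\<^sub>R (w + e) = (2 / (1 + t)) *\<^sub>R (t *\<^sub>R w - e)"
    if "t > 0" for t :: real
  proof -
    define r where "r = 2 / (1 + t)"
    have r: "(1 - t) / (1 + t) = r - 1" "r * t = 2 - r"
      using that by (simp_all add: r_def field_simps)
    show ?thesis
      unfolding r_def[symmetric] r(1) scaleR_diff_right scaleR_scaleR r(2)
      by (simp add: algebra_simps scaleR_2)
  qed
  have "((w - e) - ((1 - d) / (1 + d)) *\<^sub>R (w + e)) \<bullet> ((w - e) - ((1 - c) / (1 + c)) *\<^sub>R (w + e))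
      = - (2 / (1 + d) * (2 / (1 + c)) * ((e - c *\<^sub>R w) \<bullet> (d *\<^sub>R w - e)))"
  proof -
    have "c *\<^sub>R w - e = - (e - c *\<^sub>R w)" by simp
    then show ?thesis
      unfolding ball[OF c] ball[OF d]
      by (simp only: inner_scaleR_left inner_scaleR_right inner_minus_right mult_minus_right)
        (simp only: ac_simps inner_commute)
  qed
  also have "\<dots> \<le> 0" using ew c d by simp
  finally have "norm (w - e) \<le> max \<bar>(1 - d) / (1 + d)\<bar> \<bar>(1 - c) / (1 + c)\<bar> * norm (x - y)"
    unfolding p by (rule norm_le_of_diameter)
  moreover have "reflect u x - reflect u y = w - e"
    unfolding reflect_diff w_def[symmetric] p by (simp add: scaleR_2)
  ultimately show ?thesis
    using c d by (simp add: u_def abs_divide c_def[symmetric] d_def[symmetric])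
qed

lemma GDERIV_gradient:
  assumes "\<exists>D. GDERIV f x :> D"
  shows "GDERIV f x :> gradient f x"
proof -
  obtain D where D: "GDERIV f x :> D" using assms ..
  have "E = D" if "GDERIV f x :> E" for E
  proof -
    have "(\<lambda>h. h \<bullet> E) = (\<lambda>h. h \<bullet> D)"
      using that D unfolding gderiv_def by (rule has_derivative_unique)
    then show ?thesis by (metis inner_commute vector_eq_rdot)
  qed
  with D show ?thesis unfolding gradient_def by (rule theI)
qed

theorem proposition8:
  fixes f g :: "real ^ 'n \<Rightarrow> real" and \<rho> s \<sigma> \<alpha> :: real
  assumes "\<rho> \<ge> 0" and "s > \<rho>" and "\<sigma> > 0" and "\<alpha> > 0"
    and "weakly_convex \<rho> g"
    and "second_order_differentiable f"
    and "\<And>x y. norm (gradient f x - gradient f y) \<le> \<sigma> * norm (x - y)"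
    and "convex_on UNIV (\<lambda>x. f x - s / 2 * (norm x)\<^sup>2)"
  shows "(\<alpha> \<le> 1 / sqrt (\<sigma> * s) \<longrightarrow>
           (\<forall>x y. norm (T_op \<alpha> f g x - T_op \<alpha> f g y)
              \<le> ((1 - \<alpha>\<^sup>2 * s * \<rho>) - \<alpha> * (s - \<rho>)) / ((1 - \<alpha>\<^sup>2 * s * \<rho>) + \<alpha> * (s - \<rho>))
                * norm (x - y)))
       \<and> (\<alpha> \<le> 1 / s \<longrightarrow>
           (\<forall>x y. norm (V_op \<alpha> \<rho> f g x - V_op \<alpha> \<rho> f g y)
              \<le> max (\<bar>1 - \<alpha> * (\<sigma> - \<rho>)\<bar> / (1 + \<alpha> * (\<sigma> - \<rho>)))
                    ((1 - \<alpha> * (s - \<rho>)) / (1 + \<alpha> * (s - \<rho>)))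
                * norm (x - y)))"
proof -
  interpret smooth_strongly_convex f "gradient f" s \<sigma>
    using assms by unfold_locales
      (auto simp: second_order_differentiable_def intro: GDERIV_gradient)
  have cvx_g: "convex_on UNIV (\<lambda>z. g z + \<rho> / 2 * (norm z)\<^sup>2)"
    using assms(5) by (simp add: weakly_convex_def)
  have s: "s > 0" using assms by simp
  note s\<sigma> = modulus_le
  have \<alpha>\<rho>: "\<alpha> * \<rho> < \<alpha> * s" using assms by simp
  have T: "norm (T_op \<alpha> f g x - T_op \<alpha> f g y)
      \<le> ((1 - \<alpha>\<^sup>2 * s * \<rho>) - \<alpha> * (s - \<rho>)) / ((1 - \<alpha>\<^sup>2 * s * \<rho>) + \<alpha> * (s - \<rho>)) * norm (x - y)"
    if "\<alpha> \<le> 1 / sqrt (\<sigma> * s)" for x y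
  proof -
    define a where "a = (1 - \<alpha> * s) / (1 + \<alpha> * s)"
    have "\<alpha> * sqrt (\<sigma> * s) \<le> 1" using that s assms by (simp add: field_simps)
    then have "(\<alpha> * sqrt (\<sigma> * s))\<^sup>2 \<le> 1"
      using s assms by (intro power_le_one) auto
    then have \<alpha>2: "(\<alpha> * \<sigma>) * (\<alpha> * s) \<le> 1"
      using s assms by (simp add: power_mult_distrib power2_eq_square algebra_simps)
    have "(\<alpha> * s) * (\<alpha> * s) \<le> (\<alpha> * \<sigma>) * (\<alpha> * s)" using s s\<sigma> assms by (intro mult_right_mono) auto
    with \<alpha>2 have "(\<alpha> * s)\<^sup>2 \<le> 1\<^sup>2" by (simp add: power2_eq_square)
    then have \<alpha>s: "\<alpha> * s \<le> 1" by (rule power2_le_imp_le) simp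
    have a: "a \<ge> 0" using \<alpha>s s assms by (simp add: a_def)
    \<comment> \<open>If \<alpha>\<sigma> \<le> 1, this is monotonicity of (1 - t) / (1 + t);
      otherwise cross-multiplication reduces it to \<open>\<alpha>2\<close>.\<close>
    have "\<bar>1 - \<alpha> * \<sigma>\<bar> / (1 + \<alpha> * \<sigma>) \<le> a"
    proof -
      have "\<alpha> * s \<le> \<alpha> * \<sigma>" using assms s\<sigma> by simp
      moreover have "1 + \<alpha> * \<sigma> > 0" "1 + \<alpha> * s > 0" using s assms by (simp_all add: add_pos_pos)
      ultimately show ?thesis unfolding a_def
        using \<alpha>2 by (auto simp: abs_if field_simps)
    qed
    then have "max (\<bar>1 - \<alpha> * (\<sigma> - 0)\<bar> / (1 + \<alpha> * (\<sigma> - 0))) (\<bar>1 - \<alpha> * (s - 0)\<bar> / (1 + \<alpha> * (s - 0))) = a"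
      using \<alpha>s by (simp add: a_def)
    then have f: "norm (reflect (prox \<alpha> f) x - reflect (prox \<alpha> f) y) \<le> a * norm (x - y)" for x y
      using reflect_K\<^sub>2_Lipschitz[of \<alpha> 0 x y] assms(4) s by (simp add: K\<^sub>2_zero)
    have g: "norm (reflect (prox \<alpha> g) x - reflect (prox \<alpha> g) y)
        \<le> (1 + \<alpha> * \<rho>) / (1 - \<alpha> * \<rho>) * norm (x - y)" for x y
      using reflect_K\<^sub>1_Lipschitz[OF cvx_g, of \<alpha> 0 x y] assms \<alpha>\<rho> \<alpha>s by (simp add: K\<^sub>1_zero)
    have "norm (T_op \<alpha> f g x - T_op \<alpha> f g y)
        \<le> a * norm (reflect (prox \<alpha> g) x - reflect (prox \<alpha> g) y)"
      unfolding T_op_def o_def by (rule f)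
    also have "\<dots> \<le> a * ((1 + \<alpha> * \<rho>) / (1 - \<alpha> * \<rho>) * norm (x - y))"
      by (intro mult_left_mono g a)
    also have "\<dots> = ((1 - \<alpha> * s) * (1 + \<alpha> * \<rho>)) / ((1 + \<alpha> * s) * (1 - \<alpha> * \<rho>)) * norm (x - y)"
      by (simp add: a_def)
    also have "(1 - \<alpha> * s) * (1 + \<alpha> * \<rho>) = (1 - \<alpha>\<^sup>2 * s * \<rho>) - \<alpha> * (s - \<rho>)"
      by (simp add: algebra_simps power2_eq_square)
    also have "(1 + \<alpha> * s) * (1 - \<alpha> * \<rho>) = (1 - \<alpha>\<^sup>2 * s * \<rho>) + \<alpha> * (s - \<rho>)"
      by (simp add: algebra_simps power2_eq_square)
    finally show ?thesis .
  qed
  have V: "norm (V_op \<alpha> \<rho> f g x - V_op \<alpha> \<rho> f g y)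
      \<le> max (\<bar>1 - \<alpha> * (\<sigma> - \<rho>)\<bar> / (1 + \<alpha> * (\<sigma> - \<rho>))) ((1 - \<alpha> * (s - \<rho>)) / (1 + \<alpha> * (s - \<rho>)))
        * norm (x - y)"
    if "\<alpha> \<le> 1 / s" for x y
  proof -
    define \<gamma> where "\<gamma> = max (\<bar>1 - \<alpha> * (\<sigma> - \<rho>)\<bar> / (1 + \<alpha> * (\<sigma> - \<rho>)))
      ((1 - \<alpha> * (s - \<rho>)) / (1 + \<alpha> * (s - \<rho>)))"
    have \<alpha>s: "\<alpha> * s \<le> 1" using that s by (simp add: field_simps)
    moreover have "0 \<le> \<alpha> * \<rho>" using assms by simp
    \<comment> \<open>This removes the absolute value from the \<open>s\<close> term of the
      Lipschitz bound for \<open>K\<^sub>2\<close>, which then matches \<open>\<gamma>\<close>, and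
      makes \<open>\<gamma>\<close> nonnegative.\<close>
    ultimately have le: "\<alpha> * (s - \<rho>) \<le> 1" by (simp add: algebra_simps)
    have "\<gamma> \<ge> 0" using le assms by (simp add: \<gamma>_def le_max_iff_disj)
    have f: "norm (reflect (K\<^sub>2 \<alpha> \<rho> f) x - reflect (K\<^sub>2 \<alpha> \<rho> f) y) \<le> \<gamma> * norm (x - y)" for x y
      using reflect_K\<^sub>2_Lipschitz[of \<alpha> \<rho> x y] le assms \<alpha>\<rho> \<alpha>s by (simp add: \<gamma>_def)
    \<comment> \<open>For \<tau> = \<rho> the constant is 1: the whole contraction comes from
      \<open>f\<close>.\<close>
    have g: "norm (reflect (K\<^sub>1 \<alpha> \<rho> g) x - reflect (K\<^sub>1 \<alpha> \<rho> g) y) \<le> norm (x - y)" for x y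
      using reflect_K\<^sub>1_Lipschitz[OF cvx_g, of \<alpha> \<rho> x y] assms by simp
    have "norm (V_op \<alpha> \<rho> f g x - V_op \<alpha> \<rho> f g y)
        \<le> \<gamma> * norm (reflect (K\<^sub>1 \<alpha> \<rho> g) x - reflect (K\<^sub>1 \<alpha> \<rho> g) y)"
      unfolding V_op_def o_def by (rule f)
    also have "\<dots> \<le> \<gamma> * norm (x - y)"
      by (intro mult_left_mono g \<open>\<gamma> \<ge> 0\<close>)
    finally show ?thesis by (simp add: \<gamma>_def)
  qed
  show ?thesis using T V by blast
qed

end
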